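(* Let $A\in\mathbb{R}^{n\times n}$ be symmetric and indefinite, $a,b\in\mathbb{R}^n$ and $\beta\in\mathbb{R}$. Suppose there exists $\bar x\in\mathbb{R}^n$ with $\|\bar x\|^2<1$ and $b^T\bar x<\beta$. Then the optimal value $$\min\{x^TAx+2a^Tx:\ \|x\|^2\le 1,\ b^Tx\le\beta\}$$ is equal to the optimal value of the following conic (SOCP/SDP) problem in the variables $z,\lambda_0,u_0\in\mathbb{R}$, $u\in\mathbb{R}^n$: $$\begin{array}{rl}\max & z\\[2pt] \text{s.t.} & \begin{pmatrix}-\lambda_0+\beta u_0-z & \tfrac12(2a-\beta u-bu_0)^T\\ \tfrac12(2a-\beta u-bu_0) & A+\lambda_0 I+\tfrac12(bu^T+ub^T)\end{pmatrix}\succeq 0,\\[2pt] & \|u\|\le -u_0,\\ & \lambda_0\ge 0.\end{array}$$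
   Context: $\|\cdot\|$ is the Euclidean norm, $I$ is the $n\times n$ identity matrix, and $M\succeq 0$ means that the symmetric matrix $M$ is positive semidefinite. *)

theory Defs
  imports "HOL-Analysis.Analysis"
begin

definition psd :: "real^'n^'n \<Rightarrow> bool" where
  "psd M \<longleftrightarrow> transpose M = M \<and> (\<forall>x. 0 \<le> x \<bullet> (M *v x))"

definition indefinite :: "real^'n^'n \<Rightarrow> bool" where
  "indefinite M \<longleftrightarrow> \<not> psd M \<and> \<not> psd (- M)"

definition outer :: "real^'n \<Rightarrow> real^'n \<Rightarrow> real^'n^'n" where
  "outer v w = (\<chi> i j. v $ i * w $ j)"

text \<open>The index type \<open>'n option\<close> has one more element than \<open>'n\<close>:
  \<open>None\<close> is the index of the first row and column.\<close>

definition bordered :: "real \<Rightarrow> real^'n \<Rightarrow> real^'n^'n \<Rightarrow> real^('n option)^('n option)" where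
  "bordered c v M = (\<chi> i j. case (i, j) of
       (None, None) \<Rightarrow> c
     | (None, Some l) \<Rightarrow> v $ l
     | (Some k, None) \<Rightarrow> v $ k
     | (Some k, Some l) \<Rightarrow> M $ k $ l)"

text \<open>Optimal values that are attained. An infeasible or unbounded problem, or one whose
  infimum (supremum) is not attained, has no such value.\<close>

definition is_min_value :: "('a \<Rightarrow> real) \<Rightarrow> 'a set \<Rightarrow> real \<Rightarrow> bool" where
  "is_min_value f S v \<longleftrightarrow> (\<exists>x\<in>S. f x = v) \<and> (\<forall>x\<in>S. v \<le> f x)"

definition is_max_value :: "('a \<Rightarrow> real) \<Rightarrow> 'a set \<Rightarrow> real \<Rightarrow> bool" where
  "is_max_value f S v \<longleftrightarrow> (\<exists>x\<in>S. f x = v) \<and> (\<forall>x\<in>S. f x \<le> v)"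

definition trs_objective :: "real^'n^'n \<Rightarrow> real^'n \<Rightarrow> real^'n \<Rightarrow> real" where
  "trs_objective A a x = x \<bullet> (A *v x) + 2 * (a \<bullet> x)"

definition trs_feasible :: "real^'n \<Rightarrow> real \<Rightarrow> (real^'n) set" where
  "trs_feasible b \<beta> = {x. (norm x)\<^sup>2 \<le> 1 \<and> b \<bullet> x \<le> \<beta>}"

definition conic_matrix ::
  "real^'n^'n \<Rightarrow> real^'n \<Rightarrow> real^'n \<Rightarrow> real \<Rightarrow> real \<Rightarrow> real \<Rightarrow> real \<Rightarrow> real^'n
    \<Rightarrow> real^('n option)^('n option)" where
  "conic_matrix A a b \<beta> z l0 u0 u =
     bordered (- l0 + \<beta> * u0 - z)
       ((1/2) *\<^sub>R (2 *\<^sub>R a - \<beta> *\<^sub>R u - u0 *\<^sub>R b))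
       (A + l0 *\<^sub>R mat 1 + (1/2) *\<^sub>R (outer b u + outer u b))"

definition conic_feasible ::
  "real^'n^'n \<Rightarrow> real^'n \<Rightarrow> real^'n \<Rightarrow> real \<Rightarrow> (real \<times> real \<times> real \<times> (real^'n)) set" where
  "conic_feasible A a b \<beta> =
     {(z, l0, u0, u). psd (conic_matrix A a b \<beta> z l0 u0 u) \<and> norm u \<le> - u0 \<and> 0 \<le> l0}"

end

(* Weak duality: for (z, l0, u0, u) feasible, x^T A x + 2 a^T x - z dominates
   l0 (1 - |x|^2) + (beta - b^T x) (u^T x - u0), which is nonnegative on the feasible set.

   Strong duality: let v be the minimum and q the homogenisation of x^T A x + 2 a^T x - v, so
   that q >= 0 on the part of the Lorentz cone L with g^T y >= 0, where g = (beta, -b). With J the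
   Lorentz form, the forms l J + (g w^T + w g^T) / 2 + P (l >= 0, w in L, P psd) make up a convex
   cone, closed because of the Slater point. If q were outside, a separating matrix X would be psd
   with <X, J> >= 0, X g in L and <X, q> < 0. But X = p p^T + sum of y y^T, where p in L is a
   multiple of X g and every y is orthogonal to g. Following Sturm and Zhang, orthogonal rotations
   of these vectors, which preserve the sum, reach vectors in L or -L on the side where q >= 0, so
   <X, q> >= 0, a contradiction. *)
theory Submission
  imports Defs "HOL-Library.Multiset"
begin

section \<open>Quadratic forms and positive semidefinite matrices\<close>

definition qform :: "real^'m^'m \<Rightarrow> real^'m \<Rightarrow> real" where
  "qform M x = x \<bullet> (M *v x)"

lemma inner_matrix_vector_symmetric:
  fixes M :: "real^'m^'m"
  assumes "transpose M = M"
  shows "x \<bullet> (M *v y) = y \<bullet> (M *v x)"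
  by (metis assms dot_lmul_matrix inner_commute transpose_matrix_vector)

lemma qform_add_scaled:
  assumes "transpose M = M"
  shows "qform M (x + t *\<^sub>R y) = qform M x + 2 * t * (x \<bullet> (M *v y)) + t\<^sup>2 * qform M y"
  using inner_matrix_vector_symmetric[OF assms, of y x]
  by (simp add: qform_def matrix_vector_right_distrib scaleR_matrix_vector_assoc[symmetric]
      matrix_vector_mult_scaleR inner_add_left inner_add_right power2_eq_square algebra_simps)

lemma qform_scale [simp]: "qform M (c *\<^sub>R x) = c\<^sup>2 * qform M x"
  by (simp add: qform_def matrix_vector_mult_scaleR power2_eq_square)

lemma qform_uminus [simp]: "qform M (- x) = qform M x"
  using qform_scale[of M "-1" x] by simp

text \<open>The 2x2 matrix with rows (c, s) and (s, -c) is orthogonal, so x x^T + y y^T is unchanged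
  and the cross terms cancel.\<close>

lemma qform_rotate:
  assumes "c\<^sup>2 + s\<^sup>2 = 1"
  shows "qform M (c *\<^sub>R x + s *\<^sub>R y) + qform M (s *\<^sub>R x - c *\<^sub>R y) = qform M x + qform M y"
proof -
  have "qform M (c *\<^sub>R x + s *\<^sub>R y) + qform M (s *\<^sub>R x - c *\<^sub>R y)
      = (c\<^sup>2 + s\<^sup>2) * qform M x + (c\<^sup>2 + s\<^sup>2) * qform M y"
    by (simp add: qform_def matrix_vector_right_distrib matrix_vector_mult_diff_distrib
        matrix_vector_mult_scaleR inner_add_left inner_add_right inner_diff_left inner_diff_right
        power2_eq_square algebra_simps)
  then show ?thesis using assms by simp
qed

lemma continuous_on_qform [continuous_intros]:
  assumes "continuous_on S f"
  shows "continuous_on S (\<lambda>t. qform M (f t))"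
  unfolding qform_def
  by (intro continuous_intros assms matrix_vector_mult_linear_continuous_on[THEN continuous_on_compose2]) auto

text \<open>The quarter circle cos t x + sin t y leads from x to y, and \<open>qform J\<close>
  changes sign along it.\<close>

lemma exists_rotation_qform_zero:
  assumes "qform J x \<le> 0" "0 \<le> qform J y"
  obtains c s where "c\<^sup>2 + s\<^sup>2 = 1" "qform J (c *\<^sub>R x + s *\<^sub>R y) = 0"
proof -
  have "\<exists>t. 0 \<le> t \<and> t \<le> pi/2 \<and> qform J (cos t *\<^sub>R x + sin t *\<^sub>R y) = 0"
    by (rule IVT') (use assms in \<open>auto intro!: continuous_intros\<close>)
  then obtain t where "qform J (cos t *\<^sub>R x + sin t *\<^sub>R y) = 0" by blast
  then show thesis using that[of "cos t" "sin t"] by simp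
qed

lemma outer_mult_vec: "outer v w *v x = (w \<bullet> x) *\<^sub>R v"
  by (simp add: vec_eq_iff outer_def matrix_vector_mult_def inner_vec_def sum_distrib_left
      sum_distrib_right mult_ac)

lemma inner_outer: "outer v w \<bullet> M = v \<bullet> (M *v w)"
  by (simp add: outer_def matrix_vector_mult_def inner_vec_def sum_distrib_left mult_ac)

lemma transpose_outer: "transpose (outer v w) = outer w v"
  by (simp add: vec_eq_iff outer_def transpose_def)

lemma psd_qform: "psd M \<longleftrightarrow> transpose M = M \<and> (\<forall>x. 0 \<le> qform M x)"
  by (simp add: psd_def qform_def)

lemma psd_zero: "psd 0"
  by (simp add: psd_def vec_eq_iff transpose_def)

lemma transpose_add: "transpose (M + N) = transpose M + transpose (N :: real^'m^'m)"
  by (simp add: vec_eq_iff transpose_def)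

lemma transpose_diff: "transpose (M - N) = transpose M - transpose (N :: real^'m^'m)"
  by (simp add: vec_eq_iff transpose_def)

lemma transpose_scaleR: "transpose (c *\<^sub>R M) = c *\<^sub>R transpose (M :: real^'m^'m)"
  by (simp add: vec_eq_iff transpose_def)

lemma inner_transpose: "transpose M \<bullet> transpose N = M \<bullet> (N :: real^'m^'m)"
  unfolding inner_vec_def transpose_def by simp (rule sum.swap)

lemma qform_add: "qform (M + N) x = qform M x + qform N x"
  by (simp add: qform_def matrix_vector_mult_add_rdistrib inner_add_right)

lemma qform_diff: "qform (M - N) x = qform M x - qform N x"
  by (simp add: qform_def matrix_vector_mult_diff_rdistrib inner_diff_right)

lemma qform_scaleR: "qform (c *\<^sub>R M) x = c * qform M x"
  by (simp add: qform_def scaleR_matrix_vector_assoc[symmetric])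

lemma qform_outer: "qform (outer v w) x = (v \<bullet> x) * (w \<bullet> x)"
  by (simp add: qform_def outer_mult_vec inner_commute)

section \<open>Positive semidefinite matrices as sums of rank-one terms\<close>

lemma closed_psd: "closed {P :: real^'m^'m. psd P}"
proof -
  have "closed {P :: real^'m^'m. transpose P = P \<and> (\<forall>x. 0 \<le> outer x x \<bullet> P)}"
    unfolding transpose_def
    by (intro closed_Collect_conj closed_Collect_all closed_Collect_eq closed_Collect_le
        continuous_intros)
  then show ?thesis by (simp add: psd_def inner_outer)
qed

text \<open>The quadratic t -> \<open>qform M (x + t e)\<close> is nonnegative, so its discriminant
  is not positive.\<close>

lemma psd_Cauchy_Schwarz:
  assumes "psd M"
  shows "(x \<bullet> (M *v e))\<^sup>2 \<le> qform M x * qform M e"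
proof -
  let ?a = "qform M x" and ?b = "x \<bullet> (M *v e)" and ?c = "qform M e"
  have q: "0 \<le> ?a + 2 * t * ?b + t\<^sup>2 * ?c" for t
    using assms qform_add_scaled[of M x t e] by (metis psd_qform)
  have "0 \<le> ?c" using assms by (simp add: psd_qform)
  show ?thesis
  proof (cases "?c = 0")
    case True
    have "?b = 0"
    proof (rule ccontr)
      assume "?b \<noteq> 0"
      \<comment> \<open>With ?c = 0 the quadratic is affine in t, and this t gives it the value
        -1.\<close>
      then show False using q[of "- (?a + 1) / (2 * ?b)"] True by (simp add: field_simps)
    qed
    then show ?thesis using True by simp
  next
    case False
    then have c: "?c > 0" using \<open>0 \<le> ?c\<close> by simp
    have "0 \<le> ?c * (?a + 2 * (- ?b / ?c) * ?b + (- ?b / ?c)\<^sup>2 * ?c)"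
      using q[of "- ?b / ?c"] c by (intro mult_nonneg_nonneg) auto
    also have "\<dots> = ?a * ?c - ?b\<^sup>2"
      using c by (simp add: field_simps power2_eq_square)
    finally show ?thesis by simp
  qed
qed

text \<open>If \<open>qform X e = 0\<close> the vector split off is \<open>0\<close>, because \<open>1 / sqrt 0 = 0\<close>.\<close>

lemma psd_split_off:
  fixes X :: "real^'m^'m" and e :: "real^'m"
  assumes X: "psd X"
  defines "p \<equiv> (1 / sqrt (qform X e)) *\<^sub>R (X *v e)"
  shows "psd (X - outer p p)" "(X - outer p p) *v e = 0"
    "X *v v = 0 \<Longrightarrow> (X - outer p p) *v v = 0"
proof -
  have sym: "transpose X = X" and nn: "0 \<le> qform X x" for x
    using X by (auto simp: psd_qform)
  have px: "p \<bullet> x = (x \<bullet> (X *v e)) / sqrt (qform X e)" for x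
    by (simp add: p_def inner_commute)
  have "(p \<bullet> x) * (p \<bullet> x) \<le> qform X x" for x
  proof (cases "qform X e = 0")
    case False
    then have "qform X e > 0" using nn[of e] by simp
    then show ?thesis using psd_Cauchy_Schwarz[OF X, of x e] nn[of e]
      by (simp add: px field_simps power2_eq_square)
  qed (use nn in \<open>simp add: px\<close>)
  then show "psd (X - outer p p)"
    by (simp add: psd_qform sym transpose_diff transpose_outer qform_diff qform_outer)
  show "(X - outer p p) *v e = 0"
  proof (cases "qform X e = 0")
    case True
    then have "x \<bullet> (X *v e) = 0" for x
      using psd_Cauchy_Schwarz[OF X, of x e] by simp
    then have "X *v e = 0" using inner_eq_zero_iff by blast
    then show ?thesis
      by (simp add: matrix_vector_mult_diff_rdistrib outer_mult_vec p_def)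
  next
    case False
    then have "(p \<bullet> e) *\<^sub>R p = X *v e"
      using nn[of e] by (simp add: px qform_def[symmetric]) (simp add: p_def)
    then show ?thesis
      by (simp add: matrix_vector_mult_diff_rdistrib outer_mult_vec)
  qed
  assume v: "X *v v = 0"
  then have "p \<bullet> v = 0" by (simp add: px inner_matrix_vector_symmetric[OF sym, of v e])
  then show "(X - outer p p) *v v = 0"
    using v by (simp add: matrix_vector_mult_diff_rdistrib outer_mult_vec)
qed

lemma sum_mset_nonneg:
  fixes f :: "'a \<Rightarrow> 'b :: ordered_comm_monoid_add"
  shows "(\<And>y. y \<in># Y \<Longrightarrow> 0 \<le> f y) \<Longrightarrow> 0 \<le> (\<Sum>y\<in>#Y. f y)"
  by (induction Y) auto

lemma sum_mset_nonneg_eq_0: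
  fixes f :: "'a \<Rightarrow> 'b :: ordered_comm_monoid_add"
  assumes "\<And>y. y \<in># Y \<Longrightarrow> 0 \<le> f y" "(\<Sum>y\<in>#Y. f y) = 0" "y \<in># Y"
  shows "f y = 0"
proof -
  obtain Z where Z: "Y = add_mset y Z" using assms(3) by (metis insert_DiffM)
  have "0 \<le> (\<Sum>y\<in>#Z. f y)" using assms(1) Z by (intro sum_mset_nonneg) simp
  then show ?thesis using assms(1)[of y] assms(2) Z by (simp add: add_nonneg_eq_0_iff)
qed

text \<open>A Cholesky-type elimination of X = sum of y y^T, one column at a time; the equality is
  expressed by pairing with every Q, since <y y^T, Q> = \<open>qform Q y\<close>.\<close>

lemma psd_rank_one_decomposition:
  fixes X :: "real^'m^'m"
  assumes "psd X"
  obtains Y where "\<And>Q. X \<bullet> Q = (\<Sum>y\<in>#Y. qform Q y)"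
proof -
  \<comment> \<open>S collects the columns that may still be nonzero. Splitting off along the i-th
    basis vector clears column i and keeps cleared columns zero.\<close>
  have "\<exists>Y. \<forall>Q. X \<bullet> Q = (\<Sum>y\<in>#Y. qform Q y)"
    if "finite S" "psd X" "\<forall>i. i \<notin> S \<longrightarrow> X *v axis i 1 = 0" for S and X :: "real^'m^'m"
    using that
  proof (induction S arbitrary: X rule: finite_induct)
    case empty
    then have "X = 0"
      by (simp add: vec_eq_iff matrix_vector_mult_basis column_def)
    then show ?case by (intro exI[of _ "{#}"]) simp
  next
    case (insert i S)
    define p where "p = (1 / sqrt (qform X (axis i 1))) *\<^sub>R (X *v axis i 1)"
    note split = psd_split_off[OF insert.prems(1), where e = "axis i 1", folded p_def]
    have "(X - outer p p) *v axis k 1 = 0" if "k \<notin> S" for k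
      using split(2,3) insert.prems(2) that by (cases "k = i") blast+
    then have "\<exists>Y. \<forall>Q. (X - outer p p) \<bullet> Q = (\<Sum>y\<in>#Y. qform Q y)"
      using split(1) by (intro insert.IH) blast+
    then obtain Y where Y: "(X - outer p p) \<bullet> Q = (\<Sum>y\<in>#Y. qform Q y)" for Q
      by blast
    have "X \<bullet> Q = (\<Sum>y\<in>#add_mset p Y. qform Q y)" for Q
      using Y[of Q] by (simp add: inner_diff_left inner_outer qform_def)
    then show ?case by blast
  qed
  from this[of UNIV X] show thesis using assms that by auto
qed

section \<open>Forms nonnegative on a quadratic cone cut by a halfspace\<close>

text \<open>An abstract Lorentz cone. Self-duality alone makes L a closed convex cone; the last
  condition says that J is nonnegative exactly on L and -L.\<close>

locale quadratic_cone =
  fixes J :: "real^'m^'m" and L :: "(real^'m) set"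
  assumes J_symmetric: "transpose J = J"
    and self_dual: "z \<in> L \<longleftrightarrow> (\<forall>w\<in>L. 0 \<le> z \<bullet> w)"
    and J_nonneg_iff: "0 \<le> qform J y \<longleftrightarrow> y \<in> L \<or> - y \<in> L"
begin

lemma zero_mem: "0 \<in> L"
  by (subst self_dual) simp

lemma scale_mem: "x \<in> L \<Longrightarrow> 0 \<le> c \<Longrightarrow> c *\<^sub>R x \<in> L"
  by (subst self_dual) (simp add: self_dual[of x])

lemma add_mem: "x \<in> L \<Longrightarrow> y \<in> L \<Longrightarrow> x + y \<in> L"
  by (subst self_dual) (simp add: self_dual[of x] self_dual[of y] inner_add_left)

lemma closed_cone: "closed L"
proof -
  have "L = (\<Inter>w\<in>L. {z. 0 \<le> w \<bullet> z})"
    by (rule set_eqI, subst self_dual) (simp add: inner_commute)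
  also have "closed \<dots>" by (intro closed_INT ballI) (auto intro!: closed_Collect_le continuous_intros)
  finally show ?thesis .
qed

section \<open>Rotation argument of Sturm and Zhang\<close>

context
  fixes Q :: "real^'m^'m" and g :: "real^'m"
  assumes Q_nonneg: "\<And>y. y \<in> L \<Longrightarrow> 0 \<le> g \<bullet> y \<Longrightarrow> 0 \<le> qform Q y"
begin

lemma Q_nonneg_hyperplane:
  assumes "0 \<le> qform J y" "g \<bullet> y = 0"
  shows "0 \<le> qform Q y"
  using assms Q_nonneg[of y] Q_nonneg[of "- y"] by (auto simp: J_nonneg_iff)

text \<open>As no nonzero multiple of r lies in L or -L, a combination with c >= 0 on which J is
  nonnegative must lie in L, and there g is nonnegative because it vanishes on r. The case c < 0
  follows since the forms are even.\<close>

lemma Q_nonneg_combination: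
  assumes "p \<in> L" "0 \<le> g \<bullet> p" "g \<bullet> r = 0" "qform J r < 0"
    and "0 \<le> qform J (c *\<^sub>R p + d *\<^sub>R r)"
  shows "0 \<le> qform Q (c *\<^sub>R p + d *\<^sub>R r)"
proof -
  have *: "0 \<le> qform Q (c *\<^sub>R p + d *\<^sub>R r)"
    if J: "0 \<le> qform J (c *\<^sub>R p + d *\<^sub>R r)" and c: "0 \<le> c" for c d
  proof -
    let ?y = "c *\<^sub>R p + d *\<^sub>R r"
    have cp: "c *\<^sub>R p \<in> L" using assms(1) c by (rule scale_mem)
    have "?y \<in> L"
    proof (rule ccontr)
      assume n: "?y \<notin> L"
      then have "- ?y \<in> L" using J by (simp add: J_nonneg_iff)
      from add_mem[OF this cp] have "- (d *\<^sub>R r) \<in> L" by simp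
      then have "0 \<le> qform J (d *\<^sub>R r)" by (subst J_nonneg_iff) simp
      then have "d = 0" using assms(4) by (auto simp: zero_le_mult_iff)
      then show False using n cp by simp
    qed
    then show ?thesis
      using assms(2,3) c by (intro Q_nonneg) (auto simp: inner_add_right)
  qed
  show ?thesis
  proof (cases "0 \<le> c")
    case True then show ?thesis using * assms(5) by blast
  next
    case False
    have "(- c) *\<^sub>R p + (- d) *\<^sub>R r = - (c *\<^sub>R p + d *\<^sub>R r)" by simp
    then have e: "qform M ((- c) *\<^sub>R p + (- d) *\<^sub>R r) = qform M (c *\<^sub>R p + d *\<^sub>R r)" for M
      by (simp only: qform_uminus)
    have "0 \<le> - c" using False by simp
    with *[of "- c" "- d"] show ?thesis using assms(5) unfolding e by blast
  qed
qed

text \<open>Rotating r and p until one vector is J-null leaves the other with the whole value J(p) +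
  J(r) >= 0; both are combinations of p and r.\<close>

lemma Q_nonneg_pair:
  assumes "p \<in> L" "0 \<le> g \<bullet> p" "g \<bullet> r = 0" "qform J r < 0" "0 \<le> qform J p + qform J r"
  shows "0 \<le> qform Q p + qform Q r"
proof -
  have "qform J r \<le> 0" "0 \<le> qform J p" using assms(4,5) by linarith+
  then obtain c s where cs: "c\<^sup>2 + s\<^sup>2 = 1" and z: "qform J (c *\<^sub>R r + s *\<^sub>R p) = 0"
    by (rule exists_rotation_qform_zero)
  have "0 \<le> qform J (s *\<^sub>R r - c *\<^sub>R p)"
    using qform_rotate[OF cs, of J r p] z assms(5) by simp
  then have "0 \<le> qform Q (s *\<^sub>R r - c *\<^sub>R p)"
    using Q_nonneg_combination[OF assms(1-4), of "- c" s] by simp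
  moreover have "0 \<le> qform Q (c *\<^sub>R r + s *\<^sub>R p)"
    using Q_nonneg_combination[OF assms(1-4), of s c] z by (simp add: add.commute)
  ultimately show ?thesis using qform_rotate[OF cs, of Q r p] by simp
qed

text \<open>Rotating a pair with opposite signs of \<open>J\<close> into a pair with one \<open>J\<close>-null vector
  shortens \<open>Y\<close>. Once \<open>J \<le> 0\<close> on \<open>Y\<close>, each \<open>y\<close> is matched against the multiple of \<open>p\<close>
  that compensates \<open>qform J y\<close>.\<close>

lemma Q_nonneg_sum:
  assumes "p \<in> L" "0 \<le> g \<bullet> p" "\<forall>y\<in>#Y. g \<bullet> y = 0"
    and "0 \<le> qform J p + (\<Sum>y\<in>#Y. qform J y)"
  shows "0 \<le> qform Q p + (\<Sum>y\<in>#Y. qform Q y)"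
  using assms
proof (induction "size Y" arbitrary: p Y rule: less_induct)
  case less
  show ?case
  proof (cases "\<exists>x\<in>#Y. \<exists>y\<in>#Y. qform J x < 0 \<and> 0 < qform J y")
    case True
    then obtain x y where xy: "x \<in># Y" "y \<in># Y" "qform J x < 0" "0 < qform J y" by blast
    then have "y \<in># Y - {#x#}" by (cases "x = y") (auto simp: in_diff_count)
    then obtain Z where Y: "Y = add_mset x (add_mset y Z)"
      using xy(1) by (metis insert_DiffM)
    obtain c s where cs: "c\<^sup>2 + s\<^sup>2 = 1" and z: "qform J (c *\<^sub>R x + s *\<^sub>R y) = 0"
      using exists_rotation_qform_zero[of J x y] xy by auto
    let ?u = "c *\<^sub>R x + s *\<^sub>R y" and ?w = "s *\<^sub>R x - c *\<^sub>R y"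
    have g: "g \<bullet> x = 0" "g \<bullet> y = 0" using less.prems(3) Y by auto
    \<comment> \<open>The null vector ?u contributes nothing to the J-sum, so ?w alone replaces x
      and y.\<close>
    have "0 \<le> qform Q p + (\<Sum>y\<in>#add_mset ?w Z. qform Q y)"
      using less.prems Y g qform_rotate[OF cs, of J x y] z
      by (intro less.hyps) (auto simp: inner_diff_right)
    moreover have "0 \<le> qform Q ?u"
      using z g by (intro Q_nonneg_hyperplane) (auto simp: inner_add_right)
    ultimately show ?thesis
      using Y qform_rotate[OF cs, of Q x y] by simp
  next
    case False
    show ?thesis
    proof (cases "\<forall>y\<in>#Y. 0 \<le> qform J y")
      case True
      then have "0 \<le> (\<Sum>y\<in>#Y. qform Q y)"
        using less.prems(3) by (intro sum_mset_nonneg) (auto intro: Q_nonneg_hyperplane)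
      then show ?thesis using Q_nonneg less.prems(1,2) by simp
    next
      case neg: False
      then obtain y where y: "y \<in># Y" "qform J y < 0" by (auto simp: not_le)
      then obtain Z where Y: "Y = add_mset y Z" by (metis insert_DiffM)
      \<comment> \<open>As y is negative for J, no member is positive, so p alone has to compensate
        y.\<close>
      have "(\<Sum>y\<in>#Z. qform J y) \<le> (\<Sum>y\<in>#Z. 0)"
        using False y Y by (intro sum_mset_mono) (auto simp: not_less)
      then have Jp: "- qform J y \<le> qform J p" using less.prems(4) Y by simp
      \<comment> \<open>The share of p p^T whose J-value cancels that of y. The share 1 - \<theta>
        is left for Z; square roots appear because \<open>qform\<close> is quadratic.\<close>
      define \<theta> where "\<theta> = - qform J y / qform J p"
      have \<theta>: "0 \<le> \<theta>" "\<theta> \<le> 1" "\<theta> * qform J p = - qform J y"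
        using Jp y(2) by (auto simp: \<theta>_def field_simps)
      have "0 \<le> qform Q (sqrt \<theta> *\<^sub>R p) + qform Q y"
        using less.prems Y y \<theta> by (intro Q_nonneg_pair scale_mem) auto
      moreover have "0 \<le> qform Q (sqrt (1 - \<theta>) *\<^sub>R p) + (\<Sum>y\<in>#Z. qform Q y)"
        using less.prems Y \<theta> by (intro less.hyps scale_mem) (auto simp: algebra_simps)
      ultimately show ?thesis using Y \<theta> by (simp add: algebra_simps)
    qed
  qed
qed

text \<open>Splitting X along g yields a vector p in L, a nonnegative multiple of X g, and a
  remainder annihilating g. This is the input that \<open>Q_nonneg_sum\<close> requires.\<close>

lemma Q_nonneg_inner:
  assumes X: "psd X" and "0 \<le> X \<bullet> J" and "X *v g \<in> L"
  shows "0 \<le> X \<bullet> Q"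
proof -
  define p where "p = (1 / sqrt (qform X g)) *\<^sub>R (X *v g)"
  note split = psd_split_off[OF X, where e = g, folded p_def]
  have nn: "0 \<le> qform X g" using X by (simp add: psd_qform)
  obtain Y where Y: "(X - outer p p) \<bullet> M = (\<Sum>y\<in>#Y. qform M y)" for M
    using psd_rank_one_decomposition[OF split(1)] by blast
  \<comment> \<open>Pairing with g g^T turns the remainder into a sum of squares (g . y)^2, so each
    y is orthogonal to g.\<close>
  have "(X - outer p p) \<bullet> outer g g = 0"
    by (subst inner_commute) (simp add: inner_outer split(2))
  then have sq: "(\<Sum>y\<in>#Y. (g \<bullet> y) * (g \<bullet> y)) = 0"
    using Y[of "outer g g"] by (simp add: qform_outer)
  have "g \<bullet> y = 0" if "y \<in># Y" for y
    using sum_mset_nonneg_eq_0[OF _ sq that] by simp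
  moreover have "X \<bullet> M = qform M p + (\<Sum>y\<in>#Y. qform M y)" for M
    using Y[of M] by (simp add: inner_diff_left inner_outer qform_def)
  moreover have "p \<in> L" unfolding p_def using assms(3) nn by (intro scale_mem) simp_all
  moreover have "0 \<le> g \<bullet> p" using nn by (simp add: p_def qform_def)
  ultimately show ?thesis using assms(2) Q_nonneg_sum[of p Y] by simp
qed

end

section \<open>The closed cone of certificates and separation\<close>

definition multipliers :: "(real \<times> (real^'m) \<times> (real^'m^'m)) set" where
  "multipliers = {0..} \<times> L \<times> {P. psd P}"

text \<open>Here l is the multiplier of J >= 0, w that of the product of the constraints g . y >= 0
  and y in L, and P is the positive semidefinite slack.\<close>

definition certificate :: "real^'m \<Rightarrow> real \<times> (real^'m) \<times> (real^'m^'m) \<Rightarrow> real^'m^'m" where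
  "certificate g = (\<lambda>(l, w, P). l *\<^sub>R J + (1/2) *\<^sub>R (outer g w + outer w g) + P)"

lemma linear_certificate: "linear (certificate g)"
  by (rule linearI) (auto simp: certificate_def outer_def vec_eq_iff algebra_simps)

lemma convex_cone_multipliers: "convex_cone multipliers"
  by (auto simp: convex_cone_iff multipliers_def zero_prod_def zero_mem scale_mem add_mem
      psd_zero[unfolded psd_qform] psd_qform transpose_add
      transpose_scaleR qform_add qform_scaleR)

text \<open>The Slater point forces the certificate map to vanish only at \<open>0\<close> on the multipliers,
  so the image cone has a compact base avoiding \<open>0\<close>.\<close>

lemma closed_certificate_image:
  assumes "0 < qform J h" "0 < g \<bullet> h" "\<And>w. w \<in> L \<Longrightarrow> w \<noteq> 0 \<Longrightarrow> 0 < w \<bullet> h"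
  shows "closed (certificate g ` multipliers)"
proof -
  have inj: "m = 0" if m: "m \<in> multipliers" "certificate g m = 0" for m
  proof -
    obtain l w P where e: "m = (l, w, P)" by (cases m)
    have lwP: "0 \<le> l" "w \<in> L" "psd P" using m(1) e by (auto simp: multipliers_def)
    have eq: "l *\<^sub>R J + (1/2) *\<^sub>R (outer g w + outer w g) + P = 0"
      using m(2) e by (simp add: certificate_def)
    \<comment> \<open>At the Slater point all three terms are nonnegative, so each vanishes;
      strictness then forces l = 0 and w = 0.\<close>
    have "l * qform J h + (g \<bullet> h) * (w \<bullet> h) + qform P h = 0"
      using arg_cong[OF eq, of "\<lambda>M. qform M h"]
      by (simp add: qform_add qform_scaleR qform_outer) (simp add: qform_def)
    moreover have "0 \<le> w \<bullet> h" using assms(3) lwP by (cases "w = 0") (auto intro: less_imp_le)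
    then have "0 \<le> (g \<bullet> h) * (w \<bullet> h)" using assms(2) by simp
    moreover have "0 \<le> l * qform J h" "0 \<le> qform P h" using lwP assms(1) by (auto simp: psd_qform)
    ultimately have "l * qform J h = 0" "(g \<bullet> h) * (w \<bullet> h) = 0" by linarith+
    then have "l = 0" "w = 0" using assms lwP by (auto, force)
    moreover from this have "P = 0" using eq by (simp add: outer_def vec_eq_iff)
    ultimately show ?thesis using e by (simp add: zero_prod_def)
  qed
  have cm: "closed multipliers"
    unfolding multipliers_def by (intro closed_Times closed_psd closed_cone) auto
  let ?B = "certificate g ` (multipliers \<inter> sphere 0 1)"
  have scale: "c *\<^sub>R m \<in> multipliers" if "0 \<le> c" "m \<in> multipliers" for c m
    using convex_cone_multipliers that by (intro convex_cone_scaleR)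
  have "certificate g ` multipliers = conic hull ?B"
  proof (intro equalityI subsetI)
    fix M assume "M \<in> certificate g ` multipliers"
    then obtain m where m: "m \<in> multipliers" "M = certificate g m" by blast
    \<comment> \<open>The zero multiplier has no direction; any unit multiplier serves, as it is
      scaled by norm 0.\<close>
    define m' where "m' = (if m = 0 then (1, 0, 0) else (1 / norm m) *\<^sub>R m)"
    have "(1, 0, 0) \<in> multipliers"
      by (simp add: multipliers_def zero_mem psd_zero)
    then have "m' \<in> multipliers \<inter> sphere 0 1"
      using scale[OF _ m(1), of "1 / norm m"] by (simp add: m'_def norm_Pair)
    moreover have "m = norm m *\<^sub>R m'" by (cases "m = 0") (auto simp: m'_def zero_prod_def)
    then have "M = norm m *\<^sub>R certificate g m'"
      using m(2) linear_scale[OF linear_certificate] by metis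
    ultimately show "M \<in> conic hull ?B"
      unfolding conic_hull_explicit using norm_ge_zero[of m] by blast
  next
    fix M assume "M \<in> conic hull ?B"
    then obtain c m where "0 \<le> c" "m \<in> multipliers" "M = c *\<^sub>R certificate g m"
      by (auto simp: conic_hull_explicit)
    then have "M = certificate g (c *\<^sub>R m)" "c *\<^sub>R m \<in> multipliers"
      using scale linear_scale[OF linear_certificate] by auto
    then show "M \<in> certificate g ` multipliers" by blast
  qed
  moreover have "compact ?B"
    using cm by (intro compact_continuous_image linear_continuous_on closed_Int_compact
        linear_conv_bounded_linear[THEN iffD1] linear_certificate) auto
  moreover have "0 \<notin> ?B"
  proof
    assume "0 \<in> ?B"
    then obtain m where "m \<in> multipliers" "norm m = 1" "certificate g m = 0" by auto
    then show False using inj[of m] by simp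
  qed
  ultimately show ?thesis by (simp add: closed_conic_hull)
qed

text \<open>A theorem of S-lemma type: a hyperplane separating Q from the closed certificate cone
  yields a matrix that contradicts \<open>Q_nonneg_inner\<close>.\<close>

theorem certificate_exists:
  assumes Q: "transpose Q = Q"
    and nonneg: "\<And>y. y \<in> L \<Longrightarrow> 0 \<le> g \<bullet> y \<Longrightarrow> 0 \<le> qform Q y"
    and slater: "0 < qform J h" "0 < g \<bullet> h" "\<And>w. w \<in> L \<Longrightarrow> w \<noteq> 0 \<Longrightarrow> 0 < w \<bullet> h"
  obtains l w where "0 \<le> l" "w \<in> L"
    "psd (Q - l *\<^sub>R J - (1/2) *\<^sub>R (outer g w + outer w g))"
proof -
  let ?C = "certificate g ` multipliers"
  have "Q \<in> ?C"
  proof (rule ccontr)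
    assume "Q \<notin> ?C"
    have cc: "convex_cone ?C"
      by (simp add: convex_cone_linear_image convex_cone_multipliers linear_certificate)
    then have "convex ?C" by (simp add: convex_cone_def)
    then obtain X b where "X \<bullet> Q < b" "\<forall>M\<in>?C. b < X \<bullet> M"
      using separating_hyperplane_closed_point[OF _ closed_certificate_image[OF slater] \<open>Q \<notin> ?C\<close>]
      by metis
    then have X: "X \<bullet> Q < b" "\<And>M. M \<in> ?C \<Longrightarrow> b < X \<bullet> M" by blast+
    have "b < 0" using X(2)[OF convex_cone_contains_0[OF cc]] by simp
    have nn: "0 \<le> X \<bullet> M" if "M \<in> ?C" for M
    proof (rule ccontr)
      assume neg: "\<not> 0 \<le> X \<bullet> M"
      \<comment> \<open>The factor is positive, and X takes the value b on the scaled matrix,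
        against the strict separation.\<close>
      then have "(b / (X \<bullet> M)) *\<^sub>R M \<in> ?C"
        using that \<open>b < 0\<close>
        by (intro convex_cone_scaleR[OF cc]) (simp_all add: divide_nonpos_neg)
      from X(2)[OF this] show False using neg by simp
    qed
    \<comment> \<open>The separating X may fail to be symmetric; its symmetric part has the same
      pairing with symmetric matrices.\<close>
    define Y where "Y = (1/2) *\<^sub>R (X + transpose X)"
    have symY: "transpose Y = Y"
      by (simp add: Y_def transpose_scaleR transpose_add add.commute)
    have YM: "Y \<bullet> M = X \<bullet> M" if "transpose M = M" for M
      using inner_transpose[of X M] that by (simp add: Y_def inner_add_left)
    have mem: "l *\<^sub>R J + (1/2) *\<^sub>R (outer g w + outer w g) + P \<in> ?C"
      if "0 \<le> l" "w \<in> L" "psd P" for l w P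
      by (rule image_eqI[of _ _ "(l, w, P)"]) (use that in \<open>simp_all add: certificate_def multipliers_def\<close>)
    have out0: "outer g 0 = 0" "outer 0 g = 0" by (simp_all add: outer_def vec_eq_iff)
    have "0 \<le> Y \<bullet> J"
      using nn[OF mem[OF _ zero_mem psd_zero, of 1]] by (simp add: out0 YM J_symmetric)
    moreover have "Y *v g \<in> L"
    \<comment> \<open>By self-duality it suffices to test Y g against w in L, and (Y g) . w is the
      pairing of Y with the certificate of (0, w, 0).\<close>
    proof (subst self_dual, intro ballI)
      fix w assume w: "w \<in> L"
      let ?M = "(1/2) *\<^sub>R (outer g w + outer w g)"
      have "0 \<le> X \<bullet> ?M" using nn[OF mem[OF _ w psd_zero, of 0]] by simp
      also have "X \<bullet> ?M = Y \<bullet> ?M"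
        by (simp add: YM transpose_scaleR transpose_add transpose_outer add.commute)
      also have "\<dots> = (Y *v g) \<bullet> w"
        using inner_matrix_vector_symmetric[OF symY, of g w]
        by (simp add: inner_commute[of Y] inner_add_left inner_outer inner_commute[of _ w])
      finally show "0 \<le> (Y *v g) \<bullet> w" .
    qed
    moreover have "psd Y"
    proof -
      have "0 \<le> qform Y x" for x
      proof -
        have "psd (outer x x)" by (simp add: psd_qform transpose_outer qform_outer)
        then have "0 \<le> X \<bullet> outer x x" using nn[OF mem[OF _ zero_mem, of 0 "outer x x"]] by (simp add: out0)
        then show ?thesis
          using YM[of "outer x x"]
          by (simp add: transpose_outer inner_commute[of _ "outer x x"] inner_outer qform_def)
      qed
      then show ?thesis using symY by (simp add: psd_qform)
    qed
    ultimately have "0 \<le> Y \<bullet> Q" using Q_nonneg_inner[OF nonneg, where X = Y] by simp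
    then show False using YM[OF Q] X(1) \<open>b < 0\<close> by simp
  qed
  then obtain l w P where "0 \<le> l" "w \<in> L" "psd P"
    and "Q = l *\<^sub>R J + (1/2) *\<^sub>R (outer g w + outer w g) + P"
    by (auto simp: certificate_def multipliers_def)
  then show thesis using that[of l w] by (simp add: algebra_simps)
qed

end

section \<open>Homogenisation\<close>

definition homvec :: "real \<Rightarrow> real^'n \<Rightarrow> real^('n option)" where
  "homvec t x = (\<chi> i. case i of None \<Rightarrow> t | Some k \<Rightarrow> x $ k)"

lemma homvec_cases:
  obtains t x where "y = homvec t x"
proof
  show "y = homvec (y $ None) (\<chi> k. y $ Some k)"
    by (simp add: vec_eq_iff homvec_def split: option.split)
qed

lemma homvec_inject [simp]: "homvec t x = homvec s y \<longleftrightarrow> t = s \<and> x = y"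
  by (auto simp: vec_eq_iff homvec_def split: option.splits)

lemma uminus_homvec: "- homvec t x = homvec (- t) (- x)"
  by (simp add: vec_eq_iff homvec_def split: option.split)

lemma homvec_zero: "homvec 0 0 = 0"
  by (simp add: vec_eq_iff homvec_def split: option.split)

lemma sum_option: "(\<Sum>i\<in>UNIV. f i) = f None + (\<Sum>k\<in>UNIV. f (Some (k :: 'n :: finite)))"
  by (simp add: UNIV_option_conv sum.reindex)

lemma inner_homvec: "homvec t x \<bullet> homvec s y = t * s + x \<bullet> y"
  by (simp add: inner_vec_def sum_option homvec_def)

lemma bordered_mult_homvec:
  "bordered c v M *v homvec t x = homvec (c * t + v \<bullet> x) (t *\<^sub>R v + M *v x)"
  by (simp add: vec_eq_iff matrix_vector_mult_def sum_option bordered_def homvec_def inner_vec_def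
      mult.commute split: option.split)

lemma qform_bordered:
  "qform (bordered c v M) (homvec t x) = c * t\<^sup>2 + 2 * t * (v \<bullet> x) + qform M x"
  by (simp add: qform_def bordered_mult_homvec inner_homvec inner_add_right inner_commute
      power2_eq_square algebra_simps)

lemma transpose_bordered: "transpose (bordered c v M) = bordered c v (transpose M)"
  by (auto simp: vec_eq_iff transpose_def bordered_def split: option.split)

lemma qform_mat: "qform (mat 1) x = (norm x)\<^sup>2"
  by (simp add: qform_def dot_square_norm)

lemma qform_uminus_matrix: "qform (- M) x = - qform M x"
  using qform_scaleR[of "-1" M x] by simp

definition lorentz_matrix :: "real^('n::finite option)^('n option)" where
  "lorentz_matrix = bordered 1 0 (- mat 1)"

definition lorentz_cone :: "(real^('n::finite option)) set" where
  "lorentz_cone = {homvec t x | t x. norm x \<le> t}"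

lemma homvec_in_lorentz_cone: "homvec t x \<in> lorentz_cone \<longleftrightarrow> norm x \<le> t"
  by (auto simp: lorentz_cone_def)

lemma qform_lorentz: "qform lorentz_matrix (homvec t x) = t\<^sup>2 - (norm x)\<^sup>2"
  by (simp add: lorentz_matrix_def qform_bordered qform_mat qform_uminus_matrix)

interpretation lorentz: quadratic_cone "lorentz_matrix :: real^('n::finite option)^('n option)" lorentz_cone
proof
  show "transpose lorentz_matrix = (lorentz_matrix :: real^('n option)^('n option))"
    by (auto simp: lorentz_matrix_def transpose_bordered vec_eq_iff transpose_def mat_def
        bordered_def split: option.split)
next
  fix z :: "real^('n option)"
  obtain t x where z: "z = homvec t x" by (rule homvec_cases)
  show "z \<in> lorentz_cone \<longleftrightarrow> (\<forall>w\<in>lorentz_cone. 0 \<le> z \<bullet> w)"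
  proof
    assume "z \<in> lorentz_cone"
    then have tx: "norm x \<le> t" by (simp add: z homvec_in_lorentz_cone)
    show "\<forall>w\<in>lorentz_cone. 0 \<le> z \<bullet> w"
    proof
      fix w :: "real^('n option)" assume "w \<in> lorentz_cone"
      then obtain s y where w: "w = homvec s y" "norm y \<le> s" by (auto simp: lorentz_cone_def)
      have "- (x \<bullet> y) \<le> norm x * norm y" using Cauchy_Schwarz_ineq2[of x y] by linarith
      also have "\<dots> \<le> t * s" using tx w(2) norm_ge_zero[of x] norm_ge_zero[of y]
        by (intro mult_mono) linarith+
      finally show "0 \<le> z \<bullet> w" by (simp add: z w inner_homvec)
    qed
  next
    assume *: "\<forall>w\<in>lorentz_cone. 0 \<le> z \<bullet> w"
    \<comment> \<open>The first test vector gives |x|^2 <= |x| t, which settles x \<noteq> 0; the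
      second gives t >= 0 for x = 0.\<close>
    have "0 \<le> z \<bullet> homvec (norm x) (- x)" "0 \<le> z \<bullet> homvec 1 0"
      by (rule bspec[OF *]; simp add: homvec_in_lorentz_cone)+
    then have "norm x * norm x \<le> norm x * t" "0 \<le> t"
      by (simp_all add: z inner_homvec dot_square_norm power2_eq_square mult.commute)
    then have "norm x \<le> t" by (cases "x = 0") (auto simp: mult_le_cancel_left)
    then show "z \<in> lorentz_cone" by (simp add: z homvec_in_lorentz_cone)
  qed
next
  fix y :: "real^('n option)"
  obtain t x where y: "y = homvec t x" by (rule homvec_cases)
  have "0 \<le> t\<^sup>2 - (norm x)\<^sup>2 \<longleftrightarrow> norm x \<le> \<bar>t\<bar>"
    using abs_le_square_iff[of "norm x" t] by simp
  then show "0 \<le> qform lorentz_matrix y \<longleftrightarrow> y \<in> lorentz_cone \<or> - y \<in> lorentz_cone"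
    by (auto simp: y qform_lorentz uminus_homvec homvec_in_lorentz_cone)
qed

section \<open>Weak and strong duality\<close>

text \<open>The conic matrix is the slack P of a certificate for the homogenised objective, with g =
  (\<beta>, -b) and w = (-u0, u). The constraint |u| <= -u0 then says that w lies in the Lorentz
  cone.\<close>

lemma conic_matrix_eq:
  "conic_matrix A a b \<beta> z l u0 u =
    bordered (- z) a A - l *\<^sub>R lorentz_matrix
    - (1/2) *\<^sub>R (outer (homvec \<beta> (- b)) (homvec (- u0) u) + outer (homvec (- u0) u) (homvec \<beta> (- b)))"
  by (auto simp: vec_eq_iff conic_matrix_def bordered_def lorentz_matrix_def outer_def homvec_def
      algebra_simps split: option.split)

lemma qform_conic_matrix:
  "qform (conic_matrix A a b \<beta> z l u0 u) (homvec 1 x) =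
    trs_objective A a x - z - l * (1 - (norm x)\<^sup>2) - (\<beta> - b \<bullet> x) * (u \<bullet> x - u0)"
  by (simp add: conic_matrix_eq qform_diff qform_add qform_scaleR qform_outer qform_lorentz
      qform_bordered inner_homvec trs_objective_def) (simp add: qform_def algebra_simps)

lemma conic_feasible_le:
  assumes "(z, l, u0, u) \<in> conic_feasible A a b \<beta>" "x \<in> trs_feasible b \<beta>"
  shows "z \<le> trs_objective A a x"
proof -
  have "psd (conic_matrix A a b \<beta> z l u0 u)" and u: "norm u \<le> - u0" and l: "0 \<le> l"
    using assms(1) by (auto simp: conic_feasible_def)
  then have "0 \<le> qform (conic_matrix A a b \<beta> z l u0 u) (homvec 1 x)"
    by (simp add: psd_qform)
  moreover have x: "(norm x)\<^sup>2 \<le> 1" "b \<bullet> x \<le> \<beta>" using assms(2) by (auto simp: trs_feasible_def)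
  have "norm x \<le> 1" using x(1) by (simp add: power2_le_iff_abs_le abs_square_le_1)
  then have "norm u * norm x \<le> - u0"
    using u mult_left_le[OF _ norm_ge_zero, of "norm x" u] by simp
  \<comment> \<open>This is the pairing of (-u0, u) and (1, x), both in the self-dual Lorentz
    cone.\<close>
  then have "0 \<le> u \<bullet> x - u0" using Cauchy_Schwarz_ineq2[of u x] by linarith
  then have "0 \<le> (\<beta> - b \<bullet> x) * (u \<bullet> x - u0)" using x by simp
  moreover have "0 \<le> l * (1 - (norm x)\<^sup>2)" using l x by simp
  ultimately show ?thesis by (simp add: qform_conic_matrix)
qed

lemma trs_minimum_attained:
  assumes "trs_feasible b \<beta> \<noteq> {}"
  obtains v where "is_min_value (trs_objective A a) (trs_feasible b \<beta>) v"
proof -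
  have "trs_feasible b \<beta> = cball 0 1 \<inter> {x. b \<bullet> x \<le> \<beta>}"
    by (auto simp: trs_feasible_def abs_square_le_1)
  then have "compact (trs_feasible b \<beta>)"
    by (simp add: compact_Int_closed closed_halfspace_le)
  moreover have "continuous_on (trs_feasible b \<beta>) (trs_objective A a)"
    unfolding trs_objective_def qform_def[symmetric] by (intro continuous_intros)
  ultimately obtain x where "x \<in> trs_feasible b \<beta>"
    "\<forall>y\<in>trs_feasible b \<beta>. trs_objective A a x \<le> trs_objective A a y"
    using continuous_attains_inf assms by metis
  then show thesis using that[of "trs_objective A a x"] by (auto simp: is_min_value_def)
qed

text \<open>For t > 0 the form equals t^2 times the objective minus v at the feasible point x / t.
  For t = 0 the cone forces x = 0.\<close>

lemma qform_homogenised_nonneg: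
  assumes lower: "\<And>x. x \<in> trs_feasible b \<beta> \<Longrightarrow> v \<le> trs_objective A a x"
    and "homvec t x \<in> lorentz_cone" "0 \<le> homvec \<beta> (- b) \<bullet> homvec t x"
  shows "0 \<le> qform (bordered (- v) a A) (homvec t x)"
proof -
  have tx: "norm x \<le> t" "b \<bullet> x \<le> \<beta> * t"
    using assms(2,3) by (simp_all add: homvec_in_lorentz_cone inner_homvec)
  show ?thesis
  proof (cases "t = 0")
    case True
    then show ?thesis using tx by (simp add: qform_def homvec_zero)
  next
    case False
    then have t: "0 < t" using tx(1) norm_ge_zero[of x] by linarith
    define y where "y = (1 / t) *\<^sub>R x"
    have x: "x = t *\<^sub>R y" using t by (simp add: y_def)
    have "norm y \<le> 1" using tx(1) t by (simp add: y_def)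
    moreover have "b \<bullet> y \<le> \<beta>" using tx(2) t by (simp add: y_def field_simps)
    ultimately have "v \<le> trs_objective A a y"
      by (intro lower) (simp add: trs_feasible_def abs_square_le_1)
    then have "0 \<le> t\<^sup>2 * (trs_objective A a y - v)" by simp
    also have "\<dots> = qform (bordered (- v) a A) (homvec t x)"
      by (simp add: qform_bordered x trs_objective_def qform_def[symmetric])
        (simp add: power2_eq_square algebra_simps)
    finally show ?thesis .
  qed
qed

theorem mainTheorem3:
  fixes A :: "real^'n^'n" and a b :: "real^'n" and \<beta> :: real
  assumes "transpose A = A" and "indefinite A"
    and "\<exists>xbar :: real^'n. (norm xbar)\<^sup>2 < 1 \<and> b \<bullet> xbar < \<beta>"
  shows "\<exists>v. is_min_value (trs_objective A a) (trs_feasible b \<beta>) v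
           \<and> is_max_value (\<lambda>(z, l0, u0, u). z) (conic_feasible A a b \<beta>) v"
proof -
  obtain xbar :: "real^'n" where xbar: "(norm xbar)\<^sup>2 < 1" "b \<bullet> xbar < \<beta>"
    using assms(3) by blast
  then have "xbar \<in> trs_feasible b \<beta>" by (simp add: trs_feasible_def)
  then obtain v where v: "is_min_value (trs_objective A a) (trs_feasible b \<beta>) v"
    using trs_minimum_attained by blast
  then have lower: "v \<le> trs_objective A a x" if "x \<in> trs_feasible b \<beta>" for x
    using that by (simp add: is_min_value_def)
  \<comment> \<open>The pairing of ?g with (t, x) is \<beta> t - b . x, the homogenised linear
    constraint; ?h lifts the Slater point.\<close>
  let ?g = "homvec \<beta> (- b)" and ?h = "homvec 1 xbar"
  have nx: "norm xbar < 1" using xbar(1) by (simp add: abs_square_less_1)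
  \<comment> \<open>Since |xbar| < 1, ?h is interior to the self-dual cone, which makes the pairing
    strict.\<close>
  have interior: "0 < w \<bullet> ?h" if w: "w \<in> lorentz_cone" "w \<noteq> 0" for w :: "real^('n option)"
  proof -
    obtain s y where sy: "w = homvec s y" by (rule homvec_cases)
    then have s: "norm y \<le> s" using w by (simp add: homvec_in_lorentz_cone)
    have "s \<noteq> 0" using s w(2) sy by (auto simp: homvec_zero)
    then have "0 < s" using s norm_ge_zero[of y] by linarith
    have "- (y \<bullet> xbar) \<le> norm y * norm xbar" using Cauchy_Schwarz_ineq2[of y xbar] by linarith
    also have "\<dots> \<le> s * norm xbar" using s by (intro mult_right_mono) auto
    also have "\<dots> < s" using nx \<open>0 < s\<close> by simp
    finally show ?thesis by (simp add: sy inner_homvec)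
  qed
  have nonneg: "0 \<le> qform (bordered (- v) a A) y" if "y \<in> lorentz_cone" "0 \<le> ?g \<bullet> y" for y
  proof -
    obtain t x where "y = homvec t x" by (rule homvec_cases)
    then show ?thesis using that qform_homogenised_nonneg[OF lower, where t = t and x = x] by simp
  qed
  have slater: "0 < qform lorentz_matrix ?h" "0 < ?g \<bullet> ?h"
    using xbar by (simp_all add: qform_lorentz inner_homvec)
  have "transpose (bordered (- v) a A) = bordered (- v) a A"
    by (simp add: transpose_bordered assms(1))
  from lorentz.certificate_exists[OF this nonneg slater interior]
  obtain l w where lw: "0 \<le> l" "w \<in> lorentz_cone"
    "psd (bordered (- v) a A - l *\<^sub>R lorentz_matrix - (1/2) *\<^sub>R (outer ?g w + outer w ?g))"
    by blast
  obtain s u where w: "w = homvec s u" by (rule homvec_cases)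
  \<comment> \<open>The first coordinate of w plays the role of -u0, hence the sign of s; this point
    attains z = v.\<close>
  have "(v, l, - s, u) \<in> conic_feasible A a b \<beta>"
    using lw by (simp add: conic_feasible_def conic_matrix_eq w homvec_in_lorentz_cone)
  moreover obtain x where "x \<in> trs_feasible b \<beta>" "trs_objective A a x = v"
    using v by (auto simp: is_min_value_def)
  then have "z \<le> v" if "(z, l', u0, u') \<in> conic_feasible A a b \<beta>" for z l' u0 u'
    using conic_feasible_le[OF that] by blast
  ultimately have "is_max_value (\<lambda>(z, l0, u0, u). z) (conic_feasible A a b \<beta>) v"
    unfolding is_max_value_def by (intro conjI bexI[of _ "(v, l, - s, u)"]) auto
  then show ?thesis using v by blast
qed

end
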